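(* Consider the Coefficient-Choosing Game with parameters $D=\mathbb R$ and degree $d\ge 2$. (1) If $d=2$, Player I has a winning strategy. (2) If $d\neq 2$, Wanda has a winning strategy (whether she is Player I or Player II).
   Context: The Coefficient-Choosing Game with parameters an integral domain $D$ and a degree $d\ge 2$: one of two players, Wanda or Nora, is designated Player I and the other Player II. Starting with Player I, the players alternately choose the coefficients $a_0,\dots,a_d\in D$ of a polynomial $f(x)=a_dx^d+\cdots+a_1x+a_0$; on each turn the player picks any not-yet-chosen index $i$ (the order is not predetermined) and a value $a_i\in D$, subject to the rule that $a_d\neq 0$ and $a_0\neq 0$. When all $d+1$ coefficients are chosen, Wanda wins if $f$ has a root in the field of fractions of $D$, and Nora wins otherwise. "A player wins" means that player has a strategy that wins no matter how the other plays. *)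

theory Defs
  imports Complex_Main "HOL-Computational_Algebra.Computational_Algebra"
begin

datatype player = Wanda | Nora

fun opponent :: "player \<Rightarrow> player" where
  "opponent Wanda = Nora"
| "opponent Nora = Wanda"

text \<open>A move \<open>(i, a)\<close> sets the coefficient of \<open>x\<^sup>i\<close> to \<open>a\<close>. A play is the list of
  the moves made so far, oldest first; a strategy maps the play so far to the next move.\<close>

type_synonym 'a play = "(nat \<times> 'a) list"
type_synonym 'a strategy = "'a play \<Rightarrow> nat \<times> 'a"

definition legal_play :: "nat \<Rightarrow> 'a::zero play \<Rightarrow> bool" where
  "legal_play d h \<longleftrightarrow>
     distinct (map fst h) \<and>
     (\<forall>(i, a) \<in> set h. i \<le> d \<and> (i = 0 \<or> i = d \<longrightarrow> a \<noteq> 0))"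

text \<open>A play in which all \<open>d + 1\<close> coefficients have been chosen.\<close>

definition complete_play :: "nat \<Rightarrow> 'a::zero play \<Rightarrow> bool" where
  "complete_play d h \<longleftrightarrow> legal_play d h \<and> length h = d + 1"

text \<open>The player who makes the move number \<open>k\<close> (counting from 0), where \<open>first\<close> is Player I.\<close>

definition mover :: "player \<Rightarrow> nat \<Rightarrow> player" where
  "mover first k = (if even k then first else opponent first)"

definition play_poly :: "'a::comm_monoid_add play \<Rightarrow> 'a poly" where
  "play_poly h = (\<Sum>(i, a) \<leftarrow> h. monom a i)"

definition has_root_in_fraction_field :: "'a::idom poly \<Rightarrow> bool" where
  "has_root_in_fraction_field f \<longleftrightarrow> (\<exists>x :: 'a fract. poly (fract_poly f) x = 0)"

fun won_by :: "player \<Rightarrow> 'a::idom play \<Rightarrow> bool" where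
  "won_by Wanda h \<longleftrightarrow> has_root_in_fraction_field (play_poly h)"
| "won_by Nora h \<longleftrightarrow> \<not> has_root_in_fraction_field (play_poly h)"

text \<open>All moves of player \<open>p\<close> in \<open>h\<close> are those prescribed by the strategy \<open>s\<close>.\<close>

definition follows :: "player \<Rightarrow> player \<Rightarrow> 'a strategy \<Rightarrow> 'a play \<Rightarrow> bool" where
  "follows first p s h \<longleftrightarrow>
     (\<forall>k < length h. mover first k = p \<longrightarrow> h ! k = s (take k h))"

text \<open>The first conjunct makes the strategy prescribe a legal move whenever it is the turn of
  \<open>p\<close>; without it, a strategy making illegal moves would win vacuously.\<close>

definition winning_strategy :: "nat \<Rightarrow> player \<Rightarrow> player \<Rightarrow> 'a::idom strategy \<Rightarrow> bool" where
  "winning_strategy d first p s \<longleftrightarrow>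
     (\<forall>h. legal_play d h \<and> length h < d + 1 \<and> follows first p s h \<and> mover first (length h) = p
        \<longrightarrow> legal_play d (h @ [s h])) \<and>
     (\<forall>h. complete_play d h \<and> follows first p s h \<longrightarrow> won_by p h)"

end

theory Submission
  imports Defs
begin

text \<open>
  Over the reals, two facts produce roots: a polynomial with \<open>a\<^sub>0 a\<^sub>d < 0\<close> has a positive root, and
  whoever fixes the last coefficient can make the value at \<open>1\<close> vanish (or arrange \<open>a\<^sub>0 a\<^sub>d < 0\<close>).
  The interesting case is \<open>d \<ge> 4\<close> even with Nora moving first and last. If Nora opens with an
  extreme coefficient, Wanda answers with the other one, of opposite sign. Otherwise Wanda plays
  \<open>a\<^sub>0 = 1\<close>, threatening \<open>a\<^sub>d = -1\<close>, so that Nora must spend a move on \<open>a\<^sub>d\<close>. From then on Wanda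
  uses up even indices, so that when two indices remain at her last move, one of them, \<open>j\<close>, is odd.
  Since \<open>f(2) + 2\<^sup>j f(-1)\<close> does not depend on \<open>a\<^sub>j\<close>, she can make it negative by the choice of the
  other coefficient. Then \<open>f\<close> takes a negative value at \<open>2\<close> or at \<open>-1\<close>, while \<open>f(0) = 1\<close>.
\<close>

section \<open>Real roots\<close>

lemma poly_fract_poly_to_fract:
  "poly (fract_poly f) (to_fract x) = to_fract (poly f x)"
  by (induction f) (auto simp: map_poly_pCons)

text \<open>A field is its own fraction field, as \<open>Fract a b\<close> equals
  \<open>to_fract (a / b)\<close>. For the reals the winning condition thus concerns real
  roots.\<close>

lemma has_root_in_fraction_field_field_iff:
  fixes f :: "'a::field poly"
  shows "has_root_in_fraction_field f \<longleftrightarrow> (\<exists>x. poly f x = 0)"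
proof
  assume "has_root_in_fraction_field f"
  then obtain z :: "'a fract" where z: "poly (fract_poly f) z = 0"
    by (auto simp: has_root_in_fraction_field_def)
  obtain a b where ab: "z = Fract a b" "b \<noteq> 0"
    by (cases z) auto
  then have "z = to_fract (a / b)"
    by (simp add: to_fract_def eq_fract)
  with z have "to_fract (poly f (a / b)) = 0"
    by (simp add: poly_fract_poly_to_fract)
  then show "\<exists>x. poly f x = 0"
    by (metis to_fract_eq_0_iff)
next
  assume "\<exists>x. poly f x = 0"
  then obtain x where "poly f x = 0" ..
  then have "poly (fract_poly f) (to_fract x) = 0"
    by (simp add: poly_fract_poly_to_fract)
  then show "has_root_in_fraction_field f"
    by (auto simp: has_root_in_fraction_field_def)
qed

lemma root_of_sign_change:
  fixes f :: "real poly"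
  assumes "poly f x * poly f y < 0"
  shows "\<exists>z. poly f z = 0"
proof (cases x y rule: linorder_cases)
  case less
  then show ?thesis using poly_IVT[of x y f] assms by auto
next
  case equal
  then show ?thesis using assms by (simp add: mult_less_0_iff)
next
  case greater
  then show ?thesis using poly_IVT[of y x f] assms by (auto simp: mult.commute)
qed

lemma poly_eventually_sign_lead_coeff:
  fixes f :: "real poly"
  assumes "f \<noteq> 0"
  shows "\<exists>x>0. poly f x * lead_coeff f > 0"
proof -
  have pos: "\<exists>x>0. poly g x > 0" if g: "lead_coeff g > 0" for g :: "real poly"
  proof -
    obtain n where n: "\<forall>x\<ge>n. lead_coeff g \<le> poly g x"
      using poly_pinfty_gt_lc[OF g] by blast
    then have "poly g (max n 1) > 0"
      using g by (meson less_le_trans max.cobounded1)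
    then show ?thesis
      by (intro exI[of _ "max n 1"]) auto
  qed
  show ?thesis
  proof (cases "lead_coeff f > 0")
    case True
    then show ?thesis using pos[of f] by (auto intro: mult_pos_pos)
  next
    case False
    then have neg: "lead_coeff f < 0"
      using assms by (meson leading_coeff_0_iff linorder_neqE_linordered_idom)
    then have "\<exists>x>0. poly (- f) x > 0"
      by (intro pos) simp
    then show ?thesis using neg by (auto intro: mult_neg_neg)
  qed
qed

text \<open>The value at 0 is \<open>coeff f 0\<close>, and far to the right \<open>f\<close> has
  the sign of \<open>coeff f d\<close>, which is nonzero and hence the leading coefficient.\<close>

lemma root_of_opposite_end_coeffs:
  fixes f :: "real poly"
  assumes "coeff f 0 * coeff f d < 0" and "degree f \<le> d"
  shows "\<exists>z. poly f z = 0"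
proof -
  have "coeff f d \<noteq> 0" using assms by auto
  then have d: "degree f = d" and "f \<noteq> 0"
    using assms(2) le_degree[of f d] by auto
  then obtain x where "poly f x * coeff f d > 0"
    using poly_eventually_sign_lead_coeff[of f] by auto
  with assms(1) have "poly f 0 * poly f x < 0"
    unfolding poly_0_coeff_0 by (auto simp: mult_less_0_iff zero_less_mult_iff)
  then show ?thesis by (rule root_of_sign_change)
qed

text \<open>Substituting \<open>- x\<close> for \<open>x\<close> negates a leading coefficient of
  odd degree, so \<open>f\<close> takes both signs.\<close>

lemma root_of_odd_degree:
  fixes f :: "real poly"
  assumes "odd (degree f)"
  shows "\<exists>z. poly f z = 0"
proof -
  define g where "g = f \<circ>\<^sub>p [:0, -1:]"
  have f: "f \<noteq> 0" using assms by auto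
  have lc: "lead_coeff g = - lead_coeff f"
    using assms by (simp add: g_def lead_coeff_comp)
  with f have "g \<noteq> 0" by auto
  obtain x where x: "poly f x * lead_coeff f > 0"
    using poly_eventually_sign_lead_coeff[OF f] by blast
  obtain y where y: "poly g y * lead_coeff g > 0"
    using poly_eventually_sign_lead_coeff[OF \<open>g \<noteq> 0\<close>] by blast
  have "poly g y = poly f (- y)"
    by (simp add: g_def poly_pcompose)
  with x y lc have "poly f x * poly f (- y) < 0"
    by (auto simp: mult_less_0_iff zero_less_mult_iff)
  then show ?thesis by (rule root_of_sign_change)
qed

lemma exists_coeff_forcing_root:
  fixes f :: "real poly"
  assumes "poly f 0 > 0" and "odd j" and "i \<noteq> j" and "i \<noteq> 0"
  shows "\<exists>a. \<forall>b. \<exists>z. poly (f + monom a i + monom b j) z = 0"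
proof -
  \<comment> \<open>The factor of \<open>a\<close> in \<open>g(2) + 2^j g(-1)\<close>, where
    \<open>b\<close> cancels because \<open>j\<close> is odd. It is nonzero: a sum of positive
    powers for even \<open>i\<close>, a difference of distinct powers of 2 for odd
    \<open>i\<close>.\<close>
  define c :: real where "c = 2 ^ i + 2 ^ j * (- 1) ^ i"
  have "(2::real) ^ i \<noteq> 2 ^ j"
    using \<open>i \<noteq> j\<close> by simp
  moreover have "(2::real) ^ i + 2 ^ j > 0" by (simp add: add_pos_pos)
  ultimately have c: "c \<noteq> 0"
    unfolding c_def by (cases "even i") auto
  \<comment> \<open>Makes the combination equal to -1; any negative target would serve.\<close>
  define a where "a = - (poly f 2 + 2 ^ j * poly f (- 1) + 1) / c"
  have "\<exists>z. poly (f + monom a i + monom b j) z = 0" for b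
  proof -
    define g where "g = f + monom a i + monom b j"
    have "poly g 2 + 2 ^ j * poly g (- 1) = poly f 2 + 2 ^ j * poly f (- 1) + a * c"
      using \<open>odd j\<close> by (simp add: g_def c_def poly_monom algebra_simps)
    also have "\<dots> = - 1"
      using c by (simp add: a_def)
    finally have *: "poly g 2 + 2 ^ j * poly g (- 1) = - 1" .
    have "poly g 2 < 0 \<or> poly g (- 1) < 0"
    proof (rule ccontr)
      assume "\<not> ?thesis"
      then have "0 \<le> poly g 2 + 2 ^ j * poly g (- 1)" by simp
      with * show False by simp
    qed
    \<comment> \<open>Neither \<open>i\<close> nor the odd \<open>j\<close> is 0, so the value at 0
      is that of \<open>f\<close>.\<close>
    moreover have "poly g 0 > 0"
      using assms by (auto simp: g_def poly_monom power_0_left intro: Nat.gr0I)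
    ultimately show ?thesis
      unfolding g_def[symmetric] using root_of_sign_change[of g 0] mult_pos_neg by metis
  qed
  then show ?thesis by blast
qed

section \<open>Plays\<close>

definition free_indices :: "nat \<Rightarrow> 'a play \<Rightarrow> nat set" where
  "free_indices d h = {..d} - fst ` set h"

lemma finite_free_indices [simp]: "finite (free_indices d h)"
  by (simp add: free_indices_def)

lemma free_indices_Nil [simp]: "free_indices d [] = {..d}"
  by (simp add: free_indices_def)

lemma free_indices_snoc [simp]: "free_indices d (h @ [(i, a)]) = free_indices d h - {i}"
  by (auto simp: free_indices_def)

lemma legal_play_Nil [simp]: "legal_play d []"
  by (simp add: legal_play_def)

lemma legal_play_snoc_iff:
  "legal_play d (h @ [(i, a)]) \<longleftrightarrow>
     legal_play d h \<and> i \<in> free_indices d h \<and> (i = 0 \<or> i = d \<longrightarrow> a \<noteq> 0)"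
  by (auto simp: legal_play_def free_indices_def)

lemma card_free_indices:
  assumes "legal_play d h"
  shows "card (free_indices d h) = d + 1 - length h"
proof -
  have "fst ` set h \<subseteq> {..d}" and "distinct (map fst h)"
    using assms by (auto simp: legal_play_def)
  moreover from this have "card (fst ` set h) = length h"
    using distinct_card[of "map fst h"] by simp
  ultimately show ?thesis
    unfolding free_indices_def by (subst card_Diff_subset) auto
qed

lemma free_indices_nonempty:
  assumes "legal_play d h" and "length h \<le> d"
  shows "\<exists>i. i \<in> free_indices d h"
  using card_free_indices[OF assms(1)] assms(2)
  by (metis Suc_eq_plus1 card.empty diff_is_0_eq ex_in_conv not_less_eq_eq)

lemma play_poly_Nil [simp]: "play_poly [] = 0"
  by (simp add: play_poly_def)

lemma play_poly_snoc [simp]: "play_poly (h @ [(i, a)]) = play_poly h + monom a i"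
  by (simp add: play_poly_def)

lemma coeff_play_poly_free:
  "i \<in> free_indices d h \<Longrightarrow> coeff (play_poly h) i = 0"
  by (induction h rule: rev_induct) (auto simp: free_indices_def)

lemma degree_play_poly_le:
  assumes "legal_play d h"
  shows "degree (play_poly h) \<le> d"
  using assms
proof (induction h rule: rev_induct)
  case (snoc m h)
  obtain i a where m: "m = (i, a)" by (cases m)
  with snoc have "degree (play_poly h) \<le> d" "i \<le> d"
    by (auto simp: legal_play_snoc_iff free_indices_def)
  then show ?case
    unfolding m play_poly_snoc by (meson degree_add_le degree_monom_le le_trans)
qed simp

text \<open>The rules demand a nonzero value at both ends, and distinctness of the indices keeps
  later moves from changing it.\<close>

lemma coeff_play_poly_end:
  assumes "legal_play d h" and "i = 0 \<or> i = d" and "i \<notin> free_indices d h"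
  shows "coeff (play_poly h) i \<noteq> 0"
  using assms(1,3)
proof (induction h rule: rev_induct)
  case Nil
  then show ?case using assms(2) by auto
next
  case (snoc m h)
  obtain k a where m: "m = (k, a)" by (cases m)
  show ?case
  proof (cases "k = i")
    case True
    then show ?thesis
      using snoc.prems assms(2) coeff_play_poly_free[of i d h] unfolding m
      by (auto simp: legal_play_snoc_iff)
  next
    case False
    then show ?thesis
      using snoc unfolding m by (auto simp: legal_play_snoc_iff)
  qed
qed

lemma exists_legal_move:
  fixes h :: "'a::zero_neq_one play"
  assumes "legal_play d h" and "length h \<le> d"
  shows "\<exists>i. legal_play d (h @ [(i, 1)])"
  using free_indices_nonempty[OF assms] assms(1) by (auto simp: legal_play_snoc_iff)

text \<open>If the last free index is an end, a value of sign opposite to the other end forces a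
  root; if it is interior, its value can be tuned to make 1 a root. \<open>d > 0\<close> keeps the
  two ends apart.\<close>

lemma exists_winning_last_move:
  fixes h :: "real play"
  assumes h: "legal_play d h" "length h = d" and "d > 0"
  shows "\<exists>m. legal_play d (h @ [m]) \<and> won_by Wanda (h @ [m])"
proof -
  have "card (free_indices d h) = 1"
    using card_free_indices[OF h(1)] h(2) by simp
  then obtain i where i: "free_indices d h = {i}"
    by (auto simp: card_1_singleton_iff)
  let ?f = "play_poly h"
  have opposite: ?thesis
    if "i = 0 \<or> i = d" "k = 0 \<or> k = d" "i \<noteq> k" for k
  proof -
    let ?m = "(i, - coeff ?f k)"
    have k: "coeff ?f k \<noteq> 0"
      using coeff_play_poly_end[OF h(1), of k] that i by auto
    then have legal: "legal_play d (h @ [?m])"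
      using h i by (auto simp: legal_play_snoc_iff)
    have "coeff (play_poly (h @ [?m])) i * coeff (play_poly (h @ [?m])) k
            = - (coeff ?f k * coeff ?f k)"
      using \<open>i \<noteq> k\<close> coeff_play_poly_free[of i d h] i by simp
    also have "\<dots> < 0"
      using k not_real_square_gt_zero[of "coeff ?f k"] by linarith
    finally have "coeff (play_poly (h @ [?m])) 0 * coeff (play_poly (h @ [?m])) d < 0"
      using that by (auto simp: mult.commute)
    then have "\<exists>z. poly (play_poly (h @ [?m])) z = 0"
      by (rule root_of_opposite_end_coeffs) (rule degree_play_poly_le[OF legal])
    with legal show ?thesis
      by (auto simp: has_root_in_fraction_field_field_iff)
  qed
  show ?thesis
  proof (cases "i = 0 \<or> i = d")
    case True
    then show ?thesis using opposite[of 0] opposite[of d] \<open>d > 0\<close> by auto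
  next
    case False
    \<comment> \<open>The value of a monomial at 1 is its coefficient. An interior coefficient may
      also be 0.\<close>
    let ?m = "(i, - poly ?f 1)"
    have "legal_play d (h @ [?m])"
      using h i False by (auto simp: legal_play_snoc_iff)
    moreover have "poly (play_poly (h @ [?m])) 1 = 0"
      by (simp add: poly_monom)
    ultimately show ?thesis
      by (auto simp: has_root_in_fraction_field_field_iff)
  qed
qed

section \<open>Strategies from invariants\<close>

text \<open>The strategy picks any move that preserves \<open>Inv\<close>, so that only local
  checks, one move at a time, remain for each case.\<close>

lemma winning_strategy_of_invariant:
  fixes Inv :: "'a::idom play \<Rightarrow> bool"
  assumes Nil: "Inv []"
    and legal: "\<And>h. Inv h \<Longrightarrow> legal_play d h"
    and move: "\<And>h. Inv h \<Longrightarrow> length h \<le> d \<Longrightarrow> mover first (length h) = p \<Longrightarrow> \<exists>m. Inv (h @ [m])"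
    and reply: "\<And>h m. Inv h \<Longrightarrow> length h \<le> d \<Longrightarrow> mover first (length h) \<noteq> p \<Longrightarrow>
                  legal_play d (h @ [m]) \<Longrightarrow> Inv (h @ [m])"
    and won: "\<And>h. Inv h \<Longrightarrow> length h = d + 1 \<Longrightarrow> won_by p h"
  shows "\<exists>s :: 'a strategy. winning_strategy d first p s"
proof -
  define s where "s h = (SOME m. Inv (h @ [m]))" for h
  have s: "Inv (h @ [s h])" if "Inv h" "length h \<le> d" "mover first (length h) = p" for h
    unfolding s_def using move[OF that] by (rule someI_ex)
  \<comment> \<open>A prefix of a play that follows \<open>s\<close> follows \<open>s\<close> too.
    The length bound leaves at most \<open>d\<close> moves in a proper prefix, as
    \<open>move\<close> and \<open>reply\<close> require.\<close>
  have inv: "Inv h" if "legal_play d h" "follows first p s h" "length h \<le> d + 1" for h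
    using that
  proof (induction h rule: rev_induct)
    case (snoc m h)
    obtain i a where m: "m = (i, a)" by (cases m)
    have "follows first p s h"
      unfolding follows_def
    proof (intro allI impI)
      fix k assume "k < length h" "mover first k = p"
      with snoc.prems(2) show "h ! k = s (take k h)"
        by (auto simp: follows_def nth_append dest!: spec[of _ k])
    qed
    moreover have "legal_play d h"
      using snoc.prems(1) by (simp add: m legal_play_snoc_iff)
    ultimately have "Inv h" using snoc by simp
    show ?case
    proof (cases "mover first (length h) = p")
      case True
      then have "m = s h"
        using snoc.prems(2) by (auto simp: follows_def dest!: spec[of _ "length h"])
      then show ?thesis using s \<open>Inv h\<close> True snoc.prems(3) by simp
    next
      case False
      then show ?thesis using reply \<open>Inv h\<close> snoc.prems by simp
    qed
  qed (rule Nil)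
  have "winning_strategy d first p s"
    unfolding winning_strategy_def complete_play_def
  proof (intro conjI allI impI; elim conjE)
    fix h
    assume h: "legal_play d h" "length h < d + 1" "follows first p s h" "mover first (length h) = p"
    then have "Inv h" by (intro inv) auto
    with h show "legal_play d (h @ [s h])" by (intro legal s) auto
  next
    fix h
    assume h: "legal_play d h" "length h = d + 1" "follows first p s h"
    then show "won_by p h" by (intro won inv) auto
  qed
  then show ?thesis by blast
qed

text \<open>Here \<open>P\<close> describes the positions, reached after a move of the second player, in which the
  opponent is to move.\<close>

lemma second_player_strategy:
  fixes P :: "'a::idom play \<Rightarrow> bool"
  assumes "even d" and "p \<noteq> first"
    and Nil: "P []"
    and legal: "\<And>h. P h \<Longrightarrow> legal_play d h"
    and move: "\<And>h m. P h \<Longrightarrow> length h < d \<Longrightarrow> even (length h) \<Longrightarrow> legal_play d (h @ [m]) \<Longrightarrow>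
                 \<exists>m'. P ((h @ [m]) @ [m'])"
    and won: "\<And>h m. P h \<Longrightarrow> length h = d \<Longrightarrow> legal_play d (h @ [m]) \<Longrightarrow> won_by p (h @ [m])"
  shows "\<exists>s :: 'a strategy. winning_strategy d first p s"
proof (rule winning_strategy_of_invariant)
  \<comment> \<open>After a move of the opponent only legality is asked of the new position;
    \<open>P\<close> is remembered from the position before that move.\<close>
  define Inv where "Inv h \<longleftrightarrow> legal_play d h \<and>
    (if even (length h) then P h else P (butlast h))" for h
  have mover: "mover first k = p \<longleftrightarrow> odd k" for k
    using \<open>p \<noteq> first\<close> by (cases p; cases first) (auto simp: mover_def)
  show "Inv []" using Nil by (simp add: Inv_def)
  show "legal_play d h" if "Inv h" for h using that by (simp add: Inv_def)
  show "\<exists>m. Inv (h @ [m])"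
    if h: "Inv h" "length h \<le> d" "mover first (length h) = p" for h
  proof -
    have odd: "odd (length h)" using h(3) mover by simp
    then obtain g m where g: "h = g @ [m]" by (cases h rule: rev_cases) auto
    with h odd have "P g" "legal_play d (g @ [m])" "length g < d" "even (length g)"
      by (auto simp: Inv_def)
    from move[OF this(1,3,4,2)] obtain m' where "P (h @ [m'])" using g by auto
    then show ?thesis using legal odd unfolding Inv_def by (intro exI[of _ m']) auto
  qed
  show "Inv (h @ [m])"
    if "Inv h" "mover first (length h) \<noteq> p" "legal_play d (h @ [m])" for h m
    using that mover by (auto simp: Inv_def)
  show "won_by p h" if h: "Inv h" "length h = d + 1" for h
  proof -
    \<comment> \<open>\<open>d + 1\<close> is odd, so the last move is the opponent's and
      \<open>P\<close> holds just before it.\<close>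
    obtain g m where g: "h = g @ [m]" using h(2) by (cases h rule: rev_cases) auto
    with h \<open>even d\<close> show ?thesis using won[of g m] by (auto simp: Inv_def)
  qed
qed

section \<open>The four cases\<close>

text \<open>Every complete play has a nonzero coefficient at \<open>d\<close>, so its polynomial has
  odd degree; Wanda only has to keep to the rules.\<close>

lemma wanda_wins_odd_degree:
  assumes "odd d"
  shows "\<exists>s :: real strategy. winning_strategy d first Wanda s"
proof (rule winning_strategy_of_invariant[where Inv = "legal_play d"])
  fix h :: "real play"
  assume h: "legal_play d h"
  show "\<exists>m. legal_play d (h @ [m])" if "length h \<le> d"
    using exists_legal_move[OF h that] by blast
  assume "length h = d + 1"
  then have "d \<notin> free_indices d h"
    using card_free_indices[OF h] by simp
  then have "coeff (play_poly h) d \<noteq> 0"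
    using coeff_play_poly_end[OF h] by blast
  then have "degree (play_poly h) = d"
    using degree_play_poly_le[OF h] le_degree[of "play_poly h" d] by simp
  then show "won_by Wanda h"
    using root_of_odd_degree[of "play_poly h"] assms
    by (simp add: has_root_in_fraction_field_field_iff)
qed auto

text \<open>For even \<open>d\<close> the number of moves is odd, so Player I also moves last. Until
  then any legal move will do.\<close>

lemma wanda_wins_moving_last:
  assumes "even d" and "d > 0"
  shows "\<exists>s :: real strategy. winning_strategy d Wanda Wanda s"
proof (rule winning_strategy_of_invariant
    [where Inv = "\<lambda>h. legal_play d h \<and> (length h = d + 1 \<longrightarrow> won_by Wanda h)"])
  fix h :: "real play"
  assume h: "legal_play d h \<and> (length h = d + 1 \<longrightarrow> won_by Wanda h)" and "length h \<le> d"
  show "\<exists>m. legal_play d (h @ [m]) \<and> (length (h @ [m]) = d + 1 \<longrightarrow> won_by Wanda (h @ [m]))"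
  proof (cases "length h = d")
    case True
    then show ?thesis using exists_winning_last_move[of d h] h \<open>d > 0\<close> by auto
  next
    case False
    then show ?thesis using exists_legal_move[of d h] h \<open>length h \<le> d\<close> by auto
  qed
  \<comment> \<open>Nora moves at odd lengths only, hence never completes the play, and the winning
    condition is vacuous here.\<close>
  show "legal_play d (h @ [m]) \<and> (length (h @ [m]) = d + 1 \<longrightarrow> won_by Wanda (h @ [m]))"
    if "legal_play d (h @ [m])" "mover Wanda (length h) \<noteq> Wanda" for m
    using that \<open>even d\<close> by (auto simp: mover_def)
qed auto

text \<open>Nora opens with \<open>a_1 = 0\<close> and at the end copies the chosen end coefficient
  to the other end, so that \<open>a_0 + a_2 x^2\<close> has no real root.\<close>

lemma nora_wins_degree_two_moving_first:
  "\<exists>s :: real strategy. winning_strategy 2 Nora Nora s"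
proof -
  define Inv :: "real play \<Rightarrow> bool" where "Inv h \<longleftrightarrow> legal_play 2 h \<and>
    (h \<noteq> [] \<longrightarrow> coeff (play_poly h) 1 = 0 \<and> 1 \<notin> free_indices 2 h) \<and>
    (length h = 3 \<longrightarrow> coeff (play_poly h) 0 * coeff (play_poly h) 2 > 0)" for h
  show ?thesis
  proof (rule winning_strategy_of_invariant[where Inv = Inv])
    show "Inv []" by (simp add: Inv_def)
    show "legal_play 2 h" if "Inv h" for h using that by (simp add: Inv_def)
    show "\<exists>m. Inv (h @ [m])"
      if inv: "Inv h" and "length h \<le> 2" "mover Nora (length h) = Nora" for h
    proof -
      from that(3) have "length h \<noteq> 1"
        by (auto simp: mover_def)
      with that(2) have "length h = 0 \<or> length h = 2"
        by linarith
      then show ?thesis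
      proof
        assume "length h = 0"
        then have "Inv (h @ [(1, 0)])"
          \<comment> \<open>As \<open>[] @ [m]\<close> simplifies to \<open>[m]\<close>, the rules
            for appending a move are specialised to the empty play.\<close>
          by (auto simp: Inv_def legal_play_snoc_iff[of _ "[]", simplified]
              play_poly_snoc[of "[]", simplified] free_indices_def)
        then show ?thesis ..
      next
        assume len: "length h = 2"
        have h: "legal_play 2 h" "coeff (play_poly h) 1 = 0" "1 \<notin> free_indices 2 h"
          using inv len by (auto simp: Inv_def)
        have "card (free_indices 2 h) = 1"
          using card_free_indices[OF h(1)] len by simp
        then obtain i where i: "free_indices 2 h = {i}"
          by (auto simp: card_1_singleton_iff)
        then have "i \<in> {..2} - {1}"
          using h(3) by (auto simp: free_indices_def)
        then have i02: "i = 0 \<or> i = 2" by auto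
        \<comment> \<open>The other end, which has already been chosen.\<close>
        define k where "k = 2 - i"
        have k: "i \<noteq> k" "k = 0 \<or> k = 2" "(i = 0 \<and> k = 2) \<or> (i = 2 \<and> k = 0)"
          using i02 by (auto simp: k_def)
        let ?m = "(i, coeff (play_poly h) k)"
        have nz: "coeff (play_poly h) k \<noteq> 0"
          using coeff_play_poly_end[OF h(1) k(2)] i k by auto
        have "coeff (play_poly h) i = 0"
          using coeff_play_poly_free[of i 2 h] i by simp
        then have "coeff (play_poly (h @ [?m])) i = coeff (play_poly h) k"
          and "coeff (play_poly (h @ [?m])) k = coeff (play_poly h) k"
          using k(1) by simp_all
        moreover have "0 < coeff (play_poly h) k * coeff (play_poly h) k"
          using nz not_real_square_gt_zero by blast
        ultimately have "0 < coeff (play_poly (h @ [?m])) 0 * coeff (play_poly (h @ [?m])) 2"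
          using k(3) by (elim disjE conjE) (simp_all only:)
        moreover have "legal_play 2 (h @ [?m])"
          using h(1) nz i by (simp add: legal_play_snoc_iff)
        moreover have "coeff (play_poly (h @ [?m])) 1 = 0" "1 \<notin> free_indices 2 (h @ [?m])"
          using h(2,3) i02 by auto
        ultimately have "Inv (h @ [?m])"
          unfolding Inv_def by blast
        then show ?thesis ..
      qed
    qed
    show "Inv (h @ [m])"
      if "Inv h" "length h \<le> 2" "mover Nora (length h) \<noteq> Nora" "legal_play 2 (h @ [m])" for h m
    proof -
      \<comment> \<open>Wanda moves at length 1 only: the opening has fixed \<open>a_1\<close>, and
        her move does not complete the play.\<close>
      from that have "h \<noteq> []" "length h \<noteq> 2"
        by (auto simp: mover_def)
      then show ?thesis
        using that by (cases m) (auto simp: Inv_def legal_play_snoc_iff)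
    qed
    show "won_by Nora h" if "Inv h" "length h = 2 + 1" for h
    proof -
      let ?f = "play_poly h"
      from that have legal: "legal_play 2 h" and "h \<noteq> []" by (auto simp: Inv_def)
      with that have c: "coeff ?f 1 = 0" "coeff ?f 0 * coeff ?f 2 > 0"
        by (auto simp: Inv_def)
      have "poly ?f x \<noteq> 0" for x
      proof -
        have "poly ?f x = (\<Sum>i\<le>2. coeff ?f i * x ^ i)"
          by (subst poly_as_sum_of_monoms'[OF degree_play_poly_le[OF legal], symmetric])
            (simp add: poly_sum poly_monom)
        also have "\<dots> = coeff ?f 0 + coeff ?f 2 * x\<^sup>2"
          using c(1) by (simp add: numeral_2_eq_2)
        \<comment> \<open>Multiplying by \<open>a_0\<close> treats both signs of \<open>a_0\<close>
          at once.\<close>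
        finally have "coeff ?f 0 * poly ?f x
                        = coeff ?f 0 * coeff ?f 0 + coeff ?f 0 * coeff ?f 2 * x\<^sup>2"
          by (simp add: algebra_simps)
        moreover have "coeff ?f 0 * coeff ?f 0 > 0"
          using c(2) by (metis less_irrefl mult_zero_left not_real_square_gt_zero)
        moreover have "coeff ?f 0 * coeff ?f 2 * x\<^sup>2 \<ge> 0"
          using c(2) by simp
        ultimately have "coeff ?f 0 * poly ?f x > 0" by linarith
        then show ?thesis by auto
      qed
      then show ?thesis
        by (simp add: has_root_in_fraction_field_field_iff)
    qed
  qed
qed

section \<open>Even degree above two with Wanda second: parity counts and positions\<close>

definition even_left :: "nat \<Rightarrow> 'a play \<Rightarrow> nat" where
  "even_left d h = card {i \<in> free_indices d h. even i}"

definition odd_left :: "nat \<Rightarrow> 'a play \<Rightarrow> nat" where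
  "odd_left d h = card {i \<in> free_indices d h. odd i}"

lemma even_left_add_odd_left:
  "even_left d h + odd_left d h = card (free_indices d h)"
  unfolding even_left_def odd_left_def
  by (subst card_Un_disjoint[symmetric]) (auto intro!: arg_cong[where f = card])

lemma even_left_snoc:
  assumes "i \<in> free_indices d h"
  shows "even_left d h = even_left d (h @ [(i, a)]) + (if even i then 1 else 0)"
proof -
  have "{k \<in> free_indices d h. even k} =
      (if even i then insert i {k \<in> free_indices d (h @ [(i, a)]). even k}
       else {k \<in> free_indices d (h @ [(i, a)]). even k})"
    using assms by auto
  then show ?thesis by (simp add: even_left_def)
qed

lemma odd_left_snoc:
  assumes "i \<in> free_indices d h"
  shows "odd_left d h = odd_left d (h @ [(i, a)]) + (if odd i then 1 else 0)"
proof -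
  have "{k \<in> free_indices d h. odd k} =
      (if odd i then insert i {k \<in> free_indices d (h @ [(i, a)]). odd k}
       else {k \<in> free_indices d (h @ [(i, a)]). odd k})"
    using assms by auto
  then show ?thesis by (simp add: odd_left_def)
qed

lemma even_left_Nil:
  assumes "even d"
  shows "even_left d ([] :: 'a play) = odd_left d ([] :: 'a play) + 1"
proof -
  obtain k where d: "d = 2 * k" using assms by blast
  have "{i \<in> {..d}. odd i} = (\<lambda>i. 2 * i + 1) ` {..<k}"
    by (auto simp: d elim!: oddE)
  then have "odd_left d ([] :: 'a play) = k"
    by (simp add: odd_left_def card_image inj_on_def)
  moreover have "even_left d ([] :: 'a play) + odd_left d ([] :: 'a play) = d + 1"
    by (simp add: even_left_add_odd_left)
  ultimately show ?thesis by (simp add: d)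
qed

text \<open>An unchosen coefficient of \<open>play_poly h\<close> is 0, so the strict inequality
  also says that both ends have been chosen.\<close>

definition opposite_ends :: "nat \<Rightarrow> real play \<Rightarrow> bool" where
  "opposite_ends d h \<longleftrightarrow> coeff (play_poly h) 0 * coeff (play_poly h) d < 0"

text \<open>Reached by a positive \<open>a_0\<close> after an interior opening; the threat is a
  negative \<open>a_d\<close>. If Nora averts it by taking the even index \<open>d\<close>, no
  surplus of even indices remains.\<close>

definition lead_threat :: "nat \<Rightarrow> real play \<Rightarrow> bool" where
  "lead_threat d h \<longleftrightarrow> length h = 2 \<and> coeff (play_poly h) 0 > 0 \<and> d \<in> free_indices d h \<and>
     even_left d h \<le> odd_left d h + 1"

text \<open>The phase with both ends fixed. The surplus survives each exchange of moves and secures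
  an odd free index at Wanda's last move.\<close>

definition odd_surplus :: "nat \<Rightarrow> real play \<Rightarrow> bool" where
  "odd_surplus d h \<longleftrightarrow> length h < d \<and> coeff (play_poly h) 0 > 0 \<and> d \<notin> free_indices d h \<and>
     even_left d h < odd_left d h"

definition surely_won :: "nat \<Rightarrow> real play \<Rightarrow> bool" where
  "surely_won d h \<longleftrightarrow> length h = d \<and> (\<forall>m. legal_play d (h @ [m]) \<longrightarrow> won_by Wanda (h @ [m]))"

text \<open>Both end coefficients are nonzero, so neither end is free and no later move touches
  them.\<close>

lemma opposite_ends_snoc:
  assumes "opposite_ends d h" and "legal_play d (h @ [m])"
  shows "opposite_ends d (h @ [m])"
proof -
  obtain i a where m: "m = (i, a)" by (cases m)
  have "coeff (play_poly h) i = 0"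
    using assms(2) coeff_play_poly_free[of i d h] by (simp add: m legal_play_snoc_iff)
  then have "i \<noteq> 0" "i \<noteq> d"
    using assms(1) unfolding opposite_ends_def
    by (metis less_irrefl mult_zero_left mult_zero_right)+
  then show ?thesis using assms(1) by (simp add: m opposite_ends_def)
qed

text \<open>Wanda's reply once both ends are fixed: she uses up an even index to restore the strict
  inequality, and at her last move applies \<open>exists_coeff_forcing_root\<close>.\<close>

lemma odd_surplus_step:
  assumes "even d" and g: "legal_play d g" "odd (length g)" "length g < d"
    and c: "coeff (play_poly g) 0 > 0" "d \<notin> free_indices d g"
    and le: "even_left d g \<le> odd_left d g"
  shows "\<exists>m. legal_play d (g @ [m]) \<and> (odd_surplus d (g @ [m]) \<or> surely_won d (g @ [m]))"
proof -
  have sum: "even_left d g + odd_left d g = d + 1 - length g"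
    using even_left_add_odd_left[of d g] card_free_indices[OF g(1)] by simp
  have 0: "0 \<notin> free_indices d g"
    using c(1) coeff_play_poly_free[of 0 d g] by auto
  show ?thesis
  proof (cases "length g = d - 1")
    case True
    \<comment> \<open>Two indices are left, and \<open>le\<close> rules out that both are even.
      Wanda leaves the odd \<open>j\<close> to Nora and plays the other one.\<close>
    then have "odd_left d g \<noteq> 0" and card: "card (free_indices d g) = 2"
      using sum le g(3) card_free_indices[OF g(1)] by auto
    then obtain j where j: "j \<in> free_indices d g" "odd j"
      by (auto simp: odd_left_def)
    with card have "card (free_indices d g - {j}) = 1"
      by simp
    then obtain i where i: "free_indices d g - {j} = {i}"
      by (auto simp: card_1_singleton_iff)
    then have ij: "i \<noteq> j" "i \<in> free_indices d g" "free_indices d g - {i} = {j}"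
      using j by auto
    have "i \<noteq> 0" "i \<noteq> d" using ij 0 c(2) by metis+
    obtain a where a: "\<exists>z. poly (play_poly g + monom a i + monom b j) z = 0" for b
      using exists_coeff_forcing_root[of "play_poly g" j i] c(1) j(2) ij(1) \<open>i \<noteq> 0\<close>
      unfolding poly_0_coeff_0 by blast
    have "legal_play d (g @ [(i, a)])"
      using g(1) ij \<open>i \<noteq> 0\<close> \<open>i \<noteq> d\<close> by (simp add: legal_play_snoc_iff)
    moreover have "won_by Wanda ((g @ [(i, a)]) @ [m])"
      if "legal_play d ((g @ [(i, a)]) @ [m])" for m
    proof -
      obtain k b where m: "m = (k, b)" by (cases m)
      have "k = j" using that ij(3) unfolding m legal_play_snoc_iff free_indices_snoc by auto
      then show ?thesis using a[of b]
        unfolding m play_poly_snoc won_by.simps has_root_in_fraction_field_field_iff by simp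
    qed
    ultimately show ?thesis
      using True g(3) unfolding surely_won_def by (intro exI[of _ "(i, a)"]) auto
  next
    case False
    \<comment> \<open>By parity at least four indices are free. Hence if no even one is left and
      Wanda must take an odd one, odd ones still remain.\<close>
    with g \<open>even d\<close> have len: "length g + 3 \<le> d" by presburger
    obtain i where i: "i \<in> free_indices d g" "even_left d g = 0 \<or> even i"
    proof (cases "even_left d g = 0")
      case True
      then show ?thesis using free_indices_nonempty[OF g(1)] g(3) that by auto
    next
      case False
      then have "{i \<in> free_indices d g. even i} \<noteq> {}"
        by (auto simp: even_left_def)
      then show ?thesis using that by blast
    qed
    have "i \<noteq> 0" using i 0 by metis
    have legal: "legal_play d (g @ [(i, 1)])"
      using g(1) i by (simp add: legal_play_snoc_iff)
    have "even_left d (g @ [(i, 1)]) < odd_left d (g @ [(i, 1)])"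
      using even_left_snoc[OF i(1), of 1] odd_left_snoc[OF i(1), of 1] i(2) le sum len
      by (auto split: if_splits)
    with legal show ?thesis
      using c len \<open>i \<noteq> 0\<close> unfolding odd_surplus_def by (intro exI[of _ "(i, 1)"]) auto
  qed
qed

lemma wanda_wins_moving_second:
  assumes "even d" and "d > 2"
  shows "\<exists>s :: real strategy. winning_strategy d Nora Wanda s"
proof -
  \<comment> \<open>Positions with Nora to move. The opening leads to \<open>opposite_ends\<close>
    or \<open>lead_threat\<close>; the latter leads to \<open>opposite_ends\<close> if Nora ignores
    the threat, and otherwise to \<open>odd_surplus\<close> or \<open>surely_won\<close>.\<close>
  define P where "P h \<longleftrightarrow> legal_play d h \<and>
    (h = [] \<or> opposite_ends d h \<or> lead_threat d h \<or> odd_surplus d h \<or> surely_won d h)" for h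
  show ?thesis
  proof (rule second_player_strategy[where P = P])
    show "P []" by (simp add: P_def)
    show "legal_play d h" if "P h" for h using that by (simp add: P_def)
    show "won_by Wanda (h @ [m])" if P: "P h" "length h = d" and legal: "legal_play d (h @ [m])"
      for h m
    proof -
      \<comment> \<open>The empty play and \<open>lead_threat\<close> have lengths 0 and 2, both
        below \<open>d\<close>, and \<open>odd_surplus\<close> demands a length below
        \<open>d\<close>.\<close>
      from P \<open>d > 2\<close> have "opposite_ends d h \<or> surely_won d h"
        by (auto simp: P_def lead_threat_def odd_surplus_def)
      then show ?thesis
      proof
        assume "opposite_ends d h"
        then have "opposite_ends d (h @ [m])" using legal by (rule opposite_ends_snoc)
        then show ?thesis
          using root_of_opposite_end_coeffs[OF _ degree_play_poly_le[OF legal]]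
          by (simp add: opposite_ends_def has_root_in_fraction_field_field_iff)
      next
        assume "surely_won d h"
        then show ?thesis using legal unfolding surely_won_def by blast
      qed
    qed
    show "\<exists>m'. P ((h @ [m]) @ [m'])"
      if P: "P h" and len: "length h < d" "even (length h)" and legal: "legal_play d (h @ [m])"
      for h m
    proof -
      obtain i a where m: "m = (i, a)" by (cases m)
      define g where "g = h @ [(i, a)]"
      have g: "legal_play d g" "odd (length g)" "length g < d"
        using legal len \<open>even d\<close> unfolding g_def m
        by (simp_all, metis Suc_lessI even_Suc)
      have i: "i \<in> free_indices d h" and a: "i = 0 \<or> i = d \<Longrightarrow> a \<noteq> 0"
        and h: "legal_play d h"
        using legal by (auto simp: m legal_play_snoc_iff)
      have poly: "play_poly g = play_poly h + monom a i"
        and free: "free_indices d g = free_indices d h - {i}"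
        by (simp_all add: g_def)
      have pos: "0 < a * a" if "a \<noteq> 0"
        using that by (metis not_real_square_gt_zero)
      have d0: "d \<noteq> 0" using \<open>d > 2\<close> by simp
      have "\<exists>m'. P (g @ [m'])"
      proof -
        consider "h = []" | "opposite_ends d h" | "lead_threat d h" | "odd_surplus d h"
          using P len by (auto simp: P_def surely_won_def)
        then show ?thesis
        proof cases
          case 1
          have coeff: "coeff (play_poly g) k = (if k = i then a else 0)" for k
            using poly 1 by simp
          consider "i = 0" | "i = d" | "i \<noteq> 0" "i \<noteq> d" by blast
          then show ?thesis
          proof cases
            case 1
            then have "legal_play d (g @ [(d, - a)])"
              using g(1) free \<open>h = []\<close> a d0 by (simp add: legal_play_snoc_iff)
            moreover have "opposite_ends d (g @ [(d, - a)])"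
              using a 1 d0 pos
              by (simp add: opposite_ends_def coeff)
            ultimately show ?thesis unfolding P_def by blast
          next
            case 2
            then have "legal_play d (g @ [(0, - a)])"
              using g(1) free \<open>h = []\<close> a d0 by (simp add: legal_play_snoc_iff)
            moreover have "opposite_ends d (g @ [(0, - a)])"
              using a 2 d0 pos
              by (simp add: opposite_ends_def coeff)
            ultimately show ?thesis unfolding P_def by blast
          next
            case 3
            have 0: "0 \<in> free_indices d g" using free \<open>h = []\<close> 3 by simp
            then have "legal_play d (g @ [(0, 1)])"
              using g(1) by (simp add: legal_play_snoc_iff)
            \<comment> \<open>Initially there is one even index too many. Index 0 removes an even
              one, and Nora's opening removes at worst an odd one.\<close>
            moreover have "even_left d (g @ [(0, 1)]) \<le> odd_left d (g @ [(0, 1)]) + 1"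
              using even_left_snoc[OF 0, of 1] odd_left_snoc[OF 0, of 1]
                even_left_snoc[OF i, of a] odd_left_snoc[OF i, of a]
                even_left_Nil[OF \<open>even d\<close>, where 'a = real]
                \<open>h = []\<close> by (auto simp: g_def split: if_splits)
            then have "lead_threat d (g @ [(0, 1)])"
              using 3 d0 free \<open>h = []\<close> unfolding lead_threat_def
              by (simp add: coeff) (simp add: g_def)
            ultimately show ?thesis unfolding P_def by blast
          qed
        next
          case 2
          then have "opposite_ends d g"
            using g(1) unfolding g_def by (rule opposite_ends_snoc)
          moreover obtain k where "legal_play d (g @ [(k, 1)])"
            using exists_legal_move[OF g(1)] g(3) by auto
          ultimately show ?thesis
            using opposite_ends_snoc unfolding P_def by blast
        next
          case 3
          then have c: "coeff (play_poly h) 0 > 0" and d: "d \<in> free_indices d h"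
            and le: "even_left d h \<le> odd_left d h + 1"
            by (auto simp: lead_threat_def)
          have "i \<noteq> 0" using c i coeff_play_poly_free[of 0 d h] less_irrefl by metis
          show ?thesis
          proof (cases "i = d")
            case True
            \<comment> \<open>Nora's answer to the threat costs an even index, since
              \<open>d\<close> is even.\<close>
            have "even_left d g \<le> odd_left d g"
              using le even_left_snoc[OF i, of a] odd_left_snoc[OF i, of a] True \<open>even d\<close>
              by (simp add: g_def)
            then show ?thesis
              using odd_surplus_step[OF \<open>even d\<close> g] c \<open>i \<noteq> 0\<close> True poly free
              unfolding P_def by (auto simp del: play_poly_snoc free_indices_snoc)
          next
            case False
            \<comment> \<open>The threat is carried out: a negative \<open>a_d\<close> against a
              positive \<open>a_0\<close>.\<close>
            have "legal_play d (g @ [(d, - 1)])"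
              using g(1) d False free by (simp add: legal_play_snoc_iff)
            moreover have "opposite_ends d (g @ [(d, - 1)])"
              using c \<open>i \<noteq> 0\<close> False d0 poly coeff_play_poly_free[OF d]
              by (simp add: opposite_ends_def)
            ultimately show ?thesis unfolding P_def by blast
          qed
        next
          case 4
          then have c: "coeff (play_poly h) 0 > 0" and d: "d \<notin> free_indices d h"
            and le: "even_left d h < odd_left d h"
            by (auto simp: odd_surplus_def)
          have "i \<noteq> 0" using c i coeff_play_poly_free[of 0 d h] less_irrefl by metis
          \<comment> \<open>Nora can remove at most one odd index, which weakens the strict
            inequality to a weak one.\<close>
          have "even_left d g \<le> odd_left d g"
            using le even_left_snoc[OF i, of a] odd_left_snoc[OF i, of a]
            by (auto simp: g_def split: if_splits)
          then show ?thesis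
            using odd_surplus_step[OF \<open>even d\<close> g] c \<open>i \<noteq> 0\<close> d poly free
            unfolding P_def by (auto simp del: play_poly_snoc free_indices_snoc)
        qed
      qed
      then show ?thesis by (simp add: g_def m)
    qed
  qed (use \<open>even d\<close> in auto)
qed

theorem theorem7p1:
  fixes d :: nat
  assumes "d \<ge> 2"
  shows "(d = 2 \<longrightarrow> (\<forall>first. \<exists>s :: real strategy. winning_strategy d first first s)) \<and>
         (d \<noteq> 2 \<longrightarrow> (\<forall>first. \<exists>s :: real strategy. winning_strategy d first Wanda s))"
proof (intro conjI impI allI)
  fix first
  show "\<exists>s :: real strategy. winning_strategy d first first s" if "d = 2"
    using that wanda_wins_moving_last[of d] nora_wins_degree_two_moving_first
    by (cases first) auto
  show "\<exists>s :: real strategy. winning_strategy d first Wanda s" if "d \<noteq> 2"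
    using that assms wanda_wins_odd_degree[of d first] wanda_wins_moving_last[of d]
      wanda_wins_moving_second[of d]
    by (cases first; cases "even d") auto
qed

end
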